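(* Let $d\ge 2$ and $\mathbb{F}$ a field. For every very good upper triangular $T\in{\rm Mat}_{d+1}(\mathbb{F})$ we have $\theta(b(T))=w(D(T))$.
   Context: Matrices are indexed by $0,\dots,d$; $T[i,j]$ ($0\le i\le j\le d$) is the submatrix with rows $0,\dots,j-i$ and columns $i,\dots,j$; $T$ is very good if every $T[i,j]$ is invertible. $\Delta_n=\{(r,s,t)\in\mathbb{N}^3:r+s+t=n\}$; $VF_n(\mathbb{F})$ is the set of functions $\Delta_n\to\mathbb{F}\setminus\{0\}$. $D(T)\in VF_d(\mathbb{F})$ is $(r,s,t)\mapsto\det T[t,d-r]$. For $f\in VF_d(\mathbb{F})$, $w(f)\in VF_{d-2}(\mathbb{F})$ sends $\tau=(r,s,t)$ to $\frac{f(\mu+\alpha)f(\mu+\beta)f(\mu+\gamma)}{f(\mu-\alpha)f(\mu-\beta)f(\mu-\gamma)}$ with $\mu=(r+1,s,t+1)$, $\alpha=(1,-1,0)$, $\beta=(0,1,-1)$, $\gamma=(-1,0,1)$, interpreting $f(\lambda)=1$ for $\lambda\in\mathbb{Z}^3\setminus\Delta_d$. Billiard Arrays: a line is a set of elements of $\Delta_d$ with one fixed coordinate; a black 3-clique is $\{(a+1,b,c),(a,b+1,c),(a,b,c+1)\}$ with $(a,b,c)\in\Delta_{d-1}$; a Billiard Array on a $(d+1)$-dimensional space $V$ is a map $\lambda\mapsto B_\lambda$ from $\Delta_d$ to 1-dimensional subspaces with direct sums along lines and non-direct sums on black 3-cliques; isomorphism is via linear bijections carrying $B_\lambda$ to $B'_\lambda$,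 and $BA_d(\mathbb{F})$ is the set of isomorphism classes. Each pair of adjacent locations $\lambda,\mu$ (i.e. $\lambda-\mu\in\{\pm\alpha,\pm\beta,\pm\gamma\}$) lies in a unique black 3-clique $\{\lambda,\mu,\nu\}$, and $\widetilde B_{\lambda,\mu}:B_\lambda\to B_\mu$ sends nonzero $u$ to the unique nonzero $v\in B_\mu$ with $u+v\in B_\nu$. For $\tau=(r,s,t)\in\Delta_{d-2}$ with $\lambda=(r,s+1,t+1)$, $\mu=(r+1,s,t+1)$, $\nu=(r+1,s+1,t)$, the $B$-value of $\tau$ is the scalar $c$ with $\widetilde B_{\nu,\lambda}\widetilde B_{\mu,\nu}\widetilde B_{\lambda,\mu}=c\,\mathrm{id}_{B_\lambda}$; $\theta:BA_d(\mathbb{F})\to VF_{d-2}(\mathbb{F})$ sends the class of $B$ to $\tau\mapsto$ ($B$-value of $\tau$). $b(T)$ is the isomorphism class of the Billiard Array $B_{(r,s,t)}=U_{d-r}\cap U'_{d-s}\cap U''_{d-t}$, where for a basis $\{u_i\}$ and $v_j=\sum_iT_{ij}u_i$: $U_i=\mathbb{F}u_0+\cdots+\mathbb{F}u_i$, $U'_i=\mathbb{F}u_d+\cdots+\mathbb{F}u_{d-i}$, $U''_i=\mathbb{F}v_d+\cdots+\mathbb{F}v_{d-i}$. *)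

theory Defs
  imports
    Complex_Main
    "HOL-Library.FuncSet"
    "HOL-Library.Product_Plus"
    "Jordan_Normal_Form.Determinant"
begin

section \<open>Locations and value functions\<close>

text \<open>Locations live in \<open>\<int>\<^sup>3\<close>, so that moves may leave the triangular grid.  The
  parameter \<open>n\<close> is an integer, so that the grid is empty for negative \<open>n\<close>.\<close>

type_synonym loc = "int \<times> int \<times> int"

definition Delta :: "int \<Rightarrow> loc set" where
  "Delta n = {(r, s, t). 0 \<le> r \<and> 0 \<le> s \<and> 0 \<le> t \<and> r + s + t = n}"

definition VF :: "int \<Rightarrow> (loc \<Rightarrow> 'a::zero) set" where
  "VF n = Delta n \<rightarrow>\<^sub>E (- {0})"

definition dir_alpha :: loc where "dir_alpha = (1, -1, 0)"
definition dir_beta :: loc where "dir_beta = (0, 1, -1)"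
definition dir_gamma :: loc where "dir_gamma = (-1, 0, 1)"

definition ext_one :: "int \<Rightarrow> (loc \<Rightarrow> 'a::one) \<Rightarrow> loc \<Rightarrow> 'a" where
  "ext_one n f p = (if p \<in> Delta n then f p else 1)"

definition w_map :: "nat \<Rightarrow> (loc \<Rightarrow> 'a::field) \<Rightarrow> loc \<Rightarrow> 'a" where
  "w_map d f = (\<lambda>(r, s, t) \<in> Delta (int d - 2).
     let g = ext_one (int d) f; m = (r + 1, s, t + 1) in
       (g (m + dir_alpha) * g (m + dir_beta) * g (m + dir_gamma)) /
       (g (m - dir_alpha) * g (m - dir_beta) * g (m - dir_gamma)))"

section \<open>Very good matrices\<close>

text \<open>The submatrix \<open>T[i,j]\<close> has rows \<open>0, \<dots>, j - i\<close> and columns \<open>i, \<dots>, j\<close>; it is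
  meaningful for \<open>i \<le> j\<close> only.\<close>

definition top_submat :: "'a mat \<Rightarrow> nat \<Rightarrow> nat \<Rightarrow> 'a mat" where
  "top_submat T i j = mat (j - i + 1) (j - i + 1) (\<lambda>(a, b). T $$ (a, i + b))"

definition very_good :: "nat \<Rightarrow> 'a::field mat \<Rightarrow> bool" where
  "very_good d T \<longleftrightarrow> (\<forall>i j. i \<le> j \<and> j \<le> d \<longrightarrow> invertible_mat (top_submat T i j))"

definition D_map :: "nat \<Rightarrow> 'a::field mat \<Rightarrow> loc \<Rightarrow> 'a" where
  "D_map d T = (\<lambda>(r, s, t) \<in> Delta (int d). det (top_submat T (nat t) (d - nat r)))"

lemma w_map_in_VF:
  assumes "f \<in> VF (int d)"
  shows "w_map d f \<in> VF (int d - 2)"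
proof -
  have nz: "ext_one (int d) f p \<noteq> 0" for p
    using PiE_mem[OF assms[unfolded VF_def], of p] by (auto simp: ext_one_def)
  show ?thesis
    by (auto simp: w_map_def VF_def Let_def nz)
qed

lemma D_map_in_VF:
  assumes "very_good d T"
  shows "D_map d T \<in> VF (int d)"
proof -
  have "det (top_submat T i j) \<noteq> 0" if "i \<le> j" "j \<le> d" for i j
  proof -
    let ?A = "top_submat T i j" and ?n = "j - i + 1"
    have A: "?A \<in> carrier_mat ?n ?n" by (simp add: top_submat_def)
    have "invertible_mat ?A" using assms that by (auto simp: very_good_def)
    then obtain B where B: "inverts_mat ?A B" "inverts_mat B ?A"
      by (auto simp: invertible_mat_def)
    have AB: "?A * B = 1\<^sub>m ?n" and BA: "B * ?A = 1\<^sub>m (dim_row B)"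
      using B A by (auto simp: inverts_mat_def)
    have "dim_col B = ?n" using arg_cong[OF AB, of dim_col] by simp
    moreover have "dim_row B = ?n" using arg_cong[OF BA, of dim_col] A by simp
    ultimately have "B \<in> carrier_mat ?n ?n" by auto
    then have "det ?A * det B = 1" using det_mult[OF A] AB by (metis det_one)
    then show ?thesis by auto
  qed
  then show ?thesis
    by (auto simp: D_map_def VF_def Delta_def)
qed

section \<open>Lines, cliques and adjacency\<close>

definition lines :: "nat \<Rightarrow> loc set set" where
  "lines d = {L. \<exists>c. L = {(r, s, t) \<in> Delta (int d). r = c}
                   \<or> L = {(r, s, t) \<in> Delta (int d). s = c}
                   \<or> L = {(r, s, t) \<in> Delta (int d). t = c}}"

definition black_cliques :: "nat \<Rightarrow> loc set set" where
  "black_cliques d = {{(a + 1, b, c), (a, b + 1, c), (a, b, c + 1)} | a b c.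
     (a, b, c) \<in> Delta (int d - 1)}"

text \<open>Two adjacent locations lie in exactly one black clique; this is its third element.\<close>

definition third_loc :: "nat \<Rightarrow> loc \<Rightarrow> loc \<Rightarrow> loc" where
  "third_loc d p q = (THE n. {p, q, n} \<in> black_cliques d)"

section \<open>Billiard arrays\<close>

definition direct_family :: "('i \<Rightarrow> 'v::ab_group_add set) \<Rightarrow> 'i set \<Rightarrow> bool" where
  "direct_family W L \<longleftrightarrow>
     (\<forall>x. (\<forall>p\<in>L. x p \<in> W p) \<and> (\<Sum>p\<in>L. x p) = 0 \<longrightarrow> (\<forall>p\<in>L. x p = 0))"

type_synonym ('a, 'v) scaling = "'a \<Rightarrow> 'v \<Rightarrow> 'v"

definition indexed_basis :: "('a::field, 'v::ab_group_add) scaling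
    \<Rightarrow> 'v set \<Rightarrow> nat \<Rightarrow> (nat \<Rightarrow> 'v) \<Rightarrow> bool" where
  "indexed_basis scale V d u \<longleftrightarrow>
     inj_on u {0..d} \<and> \<not> module.dependent scale (u ` {0..d}) \<and>
     module.span scale (u ` {0..d}) = V"

text \<open>The underlying space \<open>V\<close> of an array is a subspace of dimension \<open>d + 1\<close> of the ambient
  vector space, and may vary from one array to another.  Classes of arrays are therefore sets of pairs
  \<open>(V, B)\<close>, where \<open>V\<close> ranges over all such subspaces of the ambient space.\<close>

definition billiard_array :: "('a::field, 'v::ab_group_add) scaling
    \<Rightarrow> nat \<Rightarrow> 'v set \<Rightarrow> (loc \<Rightarrow> 'v set) \<Rightarrow> bool" where
  "billiard_array scale d V B \<longleftrightarrow>
     module.subspace scale V \<and> vector_space.dim scale V = d + 1 \<and>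
     B \<in> Delta (int d) \<rightarrow>\<^sub>E
       {W. module.subspace scale W \<and> W \<subseteq> V \<and> vector_space.dim scale W = 1} \<and>
     (\<forall>L\<in>lines d. direct_family B L) \<and>
     (\<forall>C\<in>black_cliques d. \<not> direct_family B C)"

definition linear_bij :: "('a::field, 'v::ab_group_add) scaling
    \<Rightarrow> 'v set \<Rightarrow> 'v set \<Rightarrow> ('v \<Rightarrow> 'v) \<Rightarrow> bool" where
  "linear_bij scale V V' \<sigma> \<longleftrightarrow>
     bij_betw \<sigma> V V' \<and>
     (\<forall>x\<in>V. \<forall>y\<in>V. \<sigma> (x + y) = \<sigma> x + \<sigma> y) \<and>
     (\<forall>c. \<forall>x\<in>V. \<sigma> (scale c x) = scale c (\<sigma> x))"

definition ba_iso :: "('a::field, 'v::ab_group_add) scaling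
    \<Rightarrow> nat \<Rightarrow> (('v set \<times> (loc \<Rightarrow> 'v set)) \<times> ('v set \<times> (loc \<Rightarrow> 'v set))) set" where
  "ba_iso scale d = {((V, B), (V', B')).
     billiard_array scale d V B \<and> billiard_array scale d V' B' \<and>
     (\<exists>\<sigma>. linear_bij scale V V' \<sigma> \<and> (\<forall>p\<in>Delta (int d). \<sigma> ` B p = B' p))}"

lemma equiv_ba_iso:
  assumes "vector_space scale"
  shows "equiv {(V, B). billiard_array scale d V B} (ba_iso scale d)"
proof (rule equivI)
  interpret vector_space scale by fact
  have "linear_bij scale V V id" for V :: "'b set"
    by (auto simp: linear_bij_def)
  then show "refl_on {(V, B). billiard_array scale d V B} (ba_iso scale d)"
    unfolding refl_on_def ba_iso_def by fastforce
  show "ba_iso scale d \<subseteq> {(V, B). billiard_array scale d V B} \<times> {(V, B). billiard_array scale d V B}"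
    by (auto simp: ba_iso_def)
  show "sym (ba_iso scale d)"
  proof (rule symI, clarsimp simp: ba_iso_def)
    fix V B V' B' \<sigma>
    assume B: "billiard_array scale d V B" "billiard_array scale d V' B'"
      and lin: "linear_bij scale V V' \<sigma>" and im: "\<forall>p\<in>Delta (int d). \<sigma> ` B p = B' p"
    let ?g = "inv_into V \<sigma>"
    have V: "subspace V" using B(1) by (simp add: billiard_array_def)
    have bij: "bij_betw \<sigma> V V'" using lin by (simp add: linear_bij_def)
    then have inj: "inj_on \<sigma> V" and im': "\<sigma> ` V = V'" by (auto simp: bij_betw_def)
    have "?g (x + y) = ?g x + ?g y" if xy: "x \<in> V'" "y \<in> V'" for x y
    proof -
      obtain a b where ab: "a \<in> V" "x = \<sigma> a" "b \<in> V" "y = \<sigma> b" using xy im' by blast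
      then have "x + y = \<sigma> (a + b)" using lin by (simp add: linear_bij_def)
      then show ?thesis using ab inj subspace_add[OF V] by simp
    qed
    moreover have "?g (scale c x) = scale c (?g x)" if x: "x \<in> V'" for c x
    proof -
      obtain a where a: "a \<in> V" "x = \<sigma> a" using x im' by blast
      then have "scale c x = \<sigma> (scale c a)" using lin by (simp add: linear_bij_def)
      then show ?thesis using a inj subspace_scale[OF V] by simp
    qed
    ultimately have "linear_bij scale V' V ?g"
      using bij by (simp add: linear_bij_def bij_betw_inv_into)
    moreover have "?g ` B' p = B p" if "p \<in> Delta (int d)" for p
    proof -
      have "B p \<subseteq> V" using B(1) that by (cases p) (auto simp: billiard_array_def PiE_def Pi_def)
      then show ?thesis using im that inj by (metis inv_into_image_cancel)
    qed
    ultimately show "\<exists>\<sigma>. linear_bij scale V' V \<sigma> \<and> (\<forall>p\<in>Delta (int d). \<sigma> ` B' p = B p)"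
      by blast
  qed
  show "trans (ba_iso scale d)"
  proof (rule transI, clarsimp simp: ba_iso_def)
    fix V1 B1 V2 B2 V3 B3 f g
    assume f: "linear_bij scale V1 V2 f" "\<forall>p\<in>Delta (int d). f ` B1 p = B2 p"
      and g: "linear_bij scale V2 V3 g" "\<forall>p\<in>Delta (int d). g ` B2 p = B3 p"
    have "linear_bij scale V1 V3 (g \<circ> f)"
      using f(1) g(1) unfolding linear_bij_def by (auto intro: bij_betw_trans dest: bij_betwE)
    moreover have "\<forall>p\<in>Delta (int d). (g \<circ> f) ` B1 p = B3 p"
      using f(2) g(2) by (metis image_comp)
    ultimately show "\<exists>h. linear_bij scale V1 V3 h \<and> (\<forall>p\<in>Delta (int d). h ` B1 p = B3 p)"
      by blast
  qed
qed

definition BA :: "('a::field, 'v::ab_group_add) scaling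
    \<Rightarrow> nat \<Rightarrow> ('v set \<times> (loc \<Rightarrow> 'v set)) set set" where
  "BA scale d = {(V, B). billiard_array scale d V B} // ba_iso scale d"

definition Btilde :: "nat \<Rightarrow> (loc \<Rightarrow> 'v::ab_group_add set) \<Rightarrow> loc \<Rightarrow> loc \<Rightarrow> 'v \<Rightarrow> 'v" where
  "Btilde d B p q x =
     (if x = 0 then 0 else THE y. y \<in> B q \<and> y \<noteq> 0 \<and> x + y \<in> B (third_loc d p q))"

definition B_value :: "('a::field, 'v::ab_group_add) scaling
    \<Rightarrow> nat \<Rightarrow> (loc \<Rightarrow> 'v set) \<Rightarrow> loc \<Rightarrow> 'a" where
  "B_value scale d B = (\<lambda>(r, s, t) \<in> Delta (int d - 2).
     let l = (r, s + 1, t + 1); m = (r + 1, s, t + 1); n = (r + 1, s + 1, t) in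
       (THE c. \<forall>x\<in>B l. Btilde d B n l (Btilde d B m n (Btilde d B l m x)) = scale c x))"

text \<open>On an isomorphism class, the common value function of its members.\<close>

definition theta :: "('a::field, 'v::ab_group_add) scaling
    \<Rightarrow> nat \<Rightarrow> ('v set \<times> (loc \<Rightarrow> 'v set)) set \<Rightarrow> loc \<Rightarrow> 'a" where
  "theta scale d X = the_elem ((\<lambda>(V, B). B_value scale d B) ` X)"

definition mat_array :: "('a::field, 'v::ab_group_add) scaling
    \<Rightarrow> nat \<Rightarrow> (nat \<Rightarrow> 'v) \<Rightarrow> 'a mat \<Rightarrow> loc \<Rightarrow> 'v set" where
  "mat_array scale d u T = (\<lambda>(r, s, t) \<in> Delta (int d).
     let v = (\<lambda>j. \<Sum>i = 0..d. scale (T $$ (i, j)) (u i));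
         U = (\<lambda>i. module.span scale (u ` {0..i}));
         U' = (\<lambda>i. module.span scale (u ` {d - i..d}));
         U'' = (\<lambda>i. module.span scale (v ` {d - i..d}))
     in U (d - nat r) \<inter> U' (d - nat s) \<inter> U'' (d - nat t))"

definition b_map :: "('a::field, 'v::ab_group_add) scaling
    \<Rightarrow> nat \<Rightarrow> 'v set \<Rightarrow> (nat \<Rightarrow> 'v) \<Rightarrow> 'a mat
    \<Rightarrow> ('v set \<times> (loc \<Rightarrow> 'v set)) set" where
  "b_map scale d V u T = ba_iso scale d `` {(V, mat_array scale d u T)}"

end

theory Submission
  imports Defs
begin

text \<open>
  Since \<open>T\<close> is upper triangular, a vector \<open>\<Sum>\<^sub>j g\<^sub>j v\<^sub>j\<close> lies in \<open>B\<^bsub>(r, s, t)\<^esub>\<close> iff \<open>g\<close> is supported on the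
  window \<open>t, \<dots>, t + s = d - r\<close> and the rows \<open>0, \<dots>, s - 1\<close> of \<open>T\<close> annihilate \<open>g\<close>.  The cofactors of the
  last row of \<open>T[t, d - r]\<close> give a generator.  Its coefficient at \<open>u\<^sub>s\<close> is \<open>D(r, s, t)\<close>, its coefficient
  at \<open>v\<^bsub>d - r\<^esub>\<close> is \<open>D(r + 1, s - 1, t)\<close>, and its coefficient at \<open>v\<^sub>t\<close> is \<open>(-1)\<^sup>s D(r, s - 1, t + 1)\<close>.
  Within a black clique, a combination of the generators of two of the spaces lies in the third one as
  soon as one of these three coefficients cancels.  So each map of the cycle defining the \<open>B\<close>-value is,
  on generators, multiplication by a ratio of values of \<open>D\<close>, and the product of the three ratios is
  \<open>w(D(T))\<close>.
\<close>

text \<open>The value of \<open>D(T)\<close> at \<open>(r, s, t)\<close> is \<open>minor T t (s + 1)\<close>; the empty determinant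
  \<open>minor T t 0 = 1\<close> accounts for the convention \<open>f(\<lambda>) = 1\<close> off the grid.\<close>

definition minor :: "'a::comm_ring_1 mat \<Rightarrow> nat \<Rightarrow> nat \<Rightarrow> 'a" where
  "minor T t n = det (mat n n (\<lambda>(a, b). T $$ (a, t + b)))"

text \<open>The coefficient at \<open>u i\<close> of the vector whose coordinates relative to the
  \<open>v j\<close> are \<open>g\<close>. Only the entries \<open>g 0, ..., g d\<close>
  enter.\<close>

definition row_app :: "'a::comm_ring_1 mat \<Rightarrow> nat \<Rightarrow> nat \<Rightarrow> (nat \<Rightarrow> 'a) \<Rightarrow> 'a" where
  "row_app T d i g = (\<Sum>j = 0..d. T $$ (i, j) * g j)"

text \<open>The coordinates, with respect to \<open>v\<^sub>0, \<dots>, v\<^sub>d\<close>, of the elements of \<open>B\<^bsub>(r, s, t)\<^esub>\<close>.\<close>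

definition coords :: "'a::comm_ring_1 mat \<Rightarrow> nat \<Rightarrow> nat \<Rightarrow> nat \<Rightarrow> (nat \<Rightarrow> 'a) set" where
  "coords T d t s = {g. (\<forall>j. j < t \<or> t + s < j \<longrightarrow> g j = 0) \<and> (\<forall>i<s. row_app T d i g = 0)}"

definition cofactor_coords :: "'a::comm_ring_1 mat \<Rightarrow> nat \<Rightarrow> nat \<Rightarrow> nat \<Rightarrow> 'a" where
  "cofactor_coords T t s j =
     (if t \<le> j \<and> j \<le> t + s
      then cofactor (mat (s + 1) (s + 1) (\<lambda>(a, b). T $$ (a, t + b))) s (j - t) else 0)"

section \<open>Row functionals, windows and cofactors\<close>

lemma minor_0 [simp]: "minor T t 0 = 1"
  by (simp add: minor_def)

lemma row_app_add: "row_app T d i (\<lambda>j. g j + h j) = row_app T d i g + row_app T d i h"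
  by (simp add: row_app_def sum.distrib algebra_simps)

lemma row_app_scale: "row_app T d i (\<lambda>j. c * g j) = c * row_app T d i g"
  by (simp add: row_app_def sum_distrib_left mult.left_commute)

lemma row_app_sum: "row_app T d i (\<lambda>j. \<Sum>p\<in>L. g p j) = (\<Sum>p\<in>L. row_app T d i (g p))"
  unfolding row_app_def sum_distrib_left by (rule sum.swap)

lemma coords_add:
  "g \<in> coords T d t s \<Longrightarrow> h \<in> coords T d t s \<Longrightarrow> (\<lambda>j. g j + h j) \<in> coords T d t s"
  by (auto simp: coords_def row_app_add)

lemma coords_scale: "g \<in> coords T d t s \<Longrightarrow> (\<lambda>j. c * g j) \<in> coords T d t s"
  by (auto simp: coords_def row_app_scale)

lemma row_app_window:
  assumes "\<And>j. j < t \<or> t + s < j \<Longrightarrow> g j = 0" "t + s \<le> d"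
  shows "row_app T d i g = (\<Sum>b = 0..<s + 1. T $$ (i, t + b) * g (t + b))"
proof -
  have "row_app T d i g = (\<Sum>j = t..<t + (s + 1). T $$ (i, j) * g j)"
    unfolding row_app_def using assms by (intro sum.mono_neutral_right) auto
  also have "\<dots> = (\<Sum>b = 0..<s + 1. T $$ (i, t + b) * g (t + b))"
    using sum.shift_bounds_nat_ivl[of "\<lambda>j. T $$ (i, j) * g j" 0 t "s + 1"]
    by (simp add: add.commute)
  finally show ?thesis .
qed

text \<open>This is column \<open>s\<close> of \<open>A * adj A = det A * 1\<close>: expanding a row
  against the cofactors of another row gives 0, against its own cofactors the determinant.\<close>

lemma row_app_cofactor_coords:
  assumes "t + s \<le> d" "i \<le> s"
  shows "row_app T d i (cofactor_coords T t s) = (if i = s then minor T t (s + 1) else 0)"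
proof -
  let ?A = "mat (s + 1) (s + 1) (\<lambda>(a, b). T $$ (a, t + b))"
  have A: "?A \<in> carrier_mat (s + 1) (s + 1)" by simp
  have "row_app T d i (cofactor_coords T t s) =
      (\<Sum>b = 0..<s + 1. T $$ (i, t + b) * cofactor ?A s b)"
    by (subst row_app_window[of t s]) (auto simp: cofactor_coords_def assms intro!: sum.cong)
  also have "\<dots> = (?A * adj_mat ?A) $$ (i, s)"
    using assms by (auto simp: adj_mat_def scalar_prod_def intro!: sum.cong)
  also have "\<dots> = (if i = s then minor T t (s + 1) else 0)"
    unfolding adj_mat(2)[OF A] using assms by (simp add: minor_def)
  finally show ?thesis .
qed

lemma cofactor_coords_mem: "t + s \<le> d \<Longrightarrow> cofactor_coords T t s \<in> coords T d t s"
  by (auto simp: coords_def row_app_cofactor_coords) (auto simp: cofactor_coords_def)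

text \<open>Deleting the last row and the last column leaves the window start \<open>t\<close>
  fixed, and the sign \<open>(- 1) ^ (s + s)\<close> is 1.\<close>

lemma cofactor_coords_last: "cofactor_coords T t s (t + s) = minor T t s"
proof -
  have "mat_delete (mat (s + 1) (s + 1) (\<lambda>(a, b). T $$ (a, t + b))) s s
      = mat s s (\<lambda>(a, b). T $$ (a, t + b))"
    by (rule eq_matI) (auto simp: mat_delete_def)
  then show ?thesis
    by (simp add: cofactor_coords_def cofactor_def minor_def)
qed

text \<open>Deleting the first column instead moves the window start to \<open>t + 1\<close>; the
  sign is that of position \<open>(s, 0)\<close>.\<close>

lemma cofactor_coords_first: "cofactor_coords T t s t = (- 1) ^ s * minor T (t + 1) s"
proof -
  have "mat_delete (mat (s + 1) (s + 1) (\<lambda>(a, b). T $$ (a, t + b))) s 0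
      = mat s s (\<lambda>(a, b). T $$ (a, t + 1 + b))"
    by (rule eq_matI) (auto simp: mat_delete_def)
  then show ?thesis
    by (simp add: cofactor_coords_def cofactor_def minor_def)
qed

text \<open>Restricted to its window, \<open>g\<close> is a vector killed by all
  \<open>s + 1\<close> rows of a square matrix with nonzero determinant.\<close>

lemma coords_eq_zeroI:
  fixes T :: "'a::field mat"
  assumes g: "g \<in> coords T d t s" and z: "row_app T d s g = 0"
    and nz: "minor T t (s + 1) \<noteq> 0" and le: "t + s \<le> d"
  shows "g = (\<lambda>_. 0)"
proof -
  let ?A = "mat (s + 1) (s + 1) (\<lambda>(a, b). T $$ (a, t + b))"
  let ?x = "Matrix.vec (s + 1) (\<lambda>b. g (t + b))"
  have A: "?A \<in> carrier_mat (s + 1) (s + 1)" by simp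
  have supp: "j < t \<or> t + s < j \<Longrightarrow> g j = 0" for j using g by (auto simp: coords_def)
  have rows: "row_app T d i g = 0" if "i < s + 1" for i
    using g z that by (cases "i = s") (auto simp: coords_def)
  have "?A *\<^sub>v ?x = 0\<^sub>v (s + 1)"
  proof (rule eq_vecI)
    fix i assume i: "i < dim_vec (0\<^sub>v (s + 1) :: 'a Matrix.vec)"
    then have "(?A *\<^sub>v ?x) $ i = row_app T d i g"
      by (subst row_app_window[OF supp le]) (auto simp: scalar_prod_def intro!: sum.cong)
    then show "(?A *\<^sub>v ?x) $ i = 0\<^sub>v (s + 1) $ i" using rows i by simp
  qed simp
  then have x: "?x = 0\<^sub>v (s + 1)"
    using nz det_0_iff_vec_prod_zero_field[OF A] vec_carrier unfolding minor_def by blast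
  have x0: "g (t + b) = 0" if "b \<le> s" for b
    using arg_cong[OF x, of "\<lambda>v. v $ b"] that by simp
  show ?thesis
  proof
    fix j show "g j = 0"
      using supp[of j] x0[of "j - t"] by (cases "j < t \<or> t + s < j") auto
  qed
qed

text \<open>Row \<open>s\<close> is injective on \<open>coords T d t s\<close>, so matching its
  value on \<open>g\<close> with a multiple of the cofactor vector forces equality. Hence the space
  is at most one-dimensional.\<close>

lemma coords_eq_multiple:
  fixes T :: "'a::field mat"
  assumes g: "g \<in> coords T d t s" and nz: "minor T t (s + 1) \<noteq> 0" and le: "t + s \<le> d"
  shows "\<exists>c. g = (\<lambda>j. c * cofactor_coords T t s j)"
proof -
  define c where "c = row_app T d s g / minor T t (s + 1)"
  let ?h = "\<lambda>j. g j + (- c) * cofactor_coords T t s j"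
  have "?h \<in> coords T d t s"
    by (intro coords_add coords_scale g cofactor_coords_mem le)
  moreover have "row_app T d s ?h = 0"
    unfolding row_app_add row_app_scale using nz le by (simp add: row_app_cofactor_coords c_def)
  ultimately have "?h = (\<lambda>_. 0)" using nz le by (rule coords_eq_zeroI)
  then have "g j = c * cofactor_coords T t s j" for j
    using fun_cong[of ?h _ j] by simp
  then show ?thesis by auto
qed

section \<open>Combinatorics of black cliques and lines\<close>

lemma black_cliqueI:
  assumes "(a, b, c) \<in> Delta (int d - 1)"
    and "C = {(a + 1, b, c), (a, b + 1, c), (a, b, c + 1)}"
  shows "C \<in> black_cliques d"
  unfolding black_cliques_def using assms by (intro CollectI exI conjI)

lemma third_locI:
  assumes "{p, q, n} \<in> black_cliques d" "p \<noteq> q" "q \<noteq> n" "p \<noteq> n"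
  shows "third_loc d p q = n"
  unfolding third_loc_def
proof (rule the_equality[where P = "\<lambda>n. {p, q, n} \<in> black_cliques d"])
  show "{p, q, n} \<in> black_cliques d" by fact
next
  fix n' assume n': "{p, q, n'} \<in> black_cliques d"
  obtain a b c where abc: "{p, q, n} = {(a + 1, b, c), (a, b + 1, c), (a, b, c + 1)}"
    using assms(1) unfolding black_cliques_def by blast
  obtain x y z where xyz: "{p, q, n'} = {(x + 1, y, z), (x, y + 1, z), (x, y, z + 1)}"
    using n' unfolding black_cliques_def by blast
  have pq: "p \<in> {(a + 1, b, c), (a, b + 1, c), (a, b, c + 1)}"
    "q \<in> {(a + 1, b, c), (a, b + 1, c), (a, b, c + 1)}"
    "p \<in> {(x + 1, y, z), (x, y + 1, z), (x, y, z + 1)}"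
    "q \<in> {(x + 1, y, z), (x, y + 1, z), (x, y, z + 1)}"
    using abc xyz by blast+
  \<comment> \<open>The base point of a black clique is the componentwise minimum of any two
    distinct members, so \<open>p\<close> and \<open>q\<close> determine it.\<close>
  have "a = x \<and> b = y \<and> c = z" using pq assms(2) by auto
  then have eq: "{p, q, n'} = {p, q, n}" using abc xyz by simp
  have "card {p, q, n'} = 3" using assms(2-4) unfolding eq by simp
  have "n' \<notin> {p, q}"
  proof
    assume "n' \<in> {p, q}"
    then have "{p, q, n'} = {p, q}" by blast
    then show False using \<open>card {p, q, n'} = 3\<close> assms(2) by simp
  qed
  then show "n' = n" using eq by blast
qed

text \<open>The family with \<open>w\<close> at \<open>p\<close>, \<open>- w\<close> at
  \<open>q\<close> and 0 elsewhere sums to zero, so directness kills it.\<close>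

lemma direct_family_disjoint:
  fixes B :: "'i \<Rightarrow> 'v::ab_group_add set"
  assumes dir: "direct_family B L" and fin: "finite L" and pq: "p \<in> L" "q \<in> L" "p \<noteq> q"
    and w: "w \<in> B p" "- w \<in> B q" and zero: "\<And>p. p \<in> L \<Longrightarrow> 0 \<in> B p"
  shows "w = 0"
proof -
  let ?x = "\<lambda>i. if i = p then w else if i = q then - w else 0"
  have "(\<Sum>i\<in>L. ?x i) = (\<Sum>i\<in>{p, q}. ?x i)"
    using fin pq by (intro sum.mono_neutral_right) auto
  also have "\<dots> = 0" using pq by simp
  finally have "(\<Sum>i\<in>L. ?x i) = 0" .
  moreover have "\<forall>i\<in>L. ?x i \<in> B i" using w zero by auto
  ultimately have "\<forall>i\<in>L. ?x i = 0"
    by (intro mp[OF spec[OF dir[unfolded direct_family_def], of ?x]] conjI)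
  then show ?thesis using pq by auto
qed

lemma finite_Delta: "finite (Delta n)"
proof (rule finite_subset)
  show "Delta n \<subseteq> {0..n} \<times> {0..n} \<times> {0..n}" by (auto simp: Delta_def)
qed simp

lemma line_subset_Delta: "L \<in> lines d \<Longrightarrow> L \<subseteq> Delta (int d)"
  unfolding lines_def by auto

lemma finite_line: "L \<in> lines d \<Longrightarrow> finite L"
  by (rule finite_subset[OF line_subset_Delta finite_Delta])

text \<open>Any two members of a black clique agree in some coordinate. This makes directness along
  lines available inside cliques.\<close>

lemma black_clique_line:
  assumes C: "C \<in> black_cliques d" and "p \<in> C" "q \<in> C"
  shows "\<exists>L\<in>lines d. p \<in> L \<and> q \<in> L"
proof -
  obtain a b c where abc: "C = {(a + 1, b, c), (a, b + 1, c), (a, b, c + 1)}"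
    "(a, b, c) \<in> Delta (int d - 1)"
    using C unfolding black_cliques_def by blast
  have lines: "{(r, s, t) \<in> Delta (int d). r = e} \<in> lines d"
    "{(r, s, t) \<in> Delta (int d). s = e} \<in> lines d"
    "{(r, s, t) \<in> Delta (int d). t = e} \<in> lines d" for e
    unfolding lines_def by (intro CollectI exI[of _ e], simp)+
  obtain p1 p2 p3 q1 q2 q3 where p: "p = (p1, p2, p3)" and q: "q = (q1, q2, q3)"
    by (cases p; cases q)
  have D: "p \<in> Delta (int d)" "q \<in> Delta (int d)"
    using assms(2,3) abc by (auto simp: Delta_def)
  have "p1 = q1 \<or> p2 = q2 \<or> p3 = q3"
    using assms(2,3) unfolding abc p q by auto
  then show ?thesis
  proof (elim disjE)
    assume "p1 = q1"
    then show ?thesis using D p q by (intro bexI[OF _ lines(1)[of p1]]) simp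
  next
    assume "p2 = q2"
    then show ?thesis using D p q by (intro bexI[OF _ lines(2)[of p2]]) simp
  next
    assume "p3 = q3"
    then show ?thesis using D p q by (intro bexI[OF _ lines(3)[of p3]]) simp
  qed
qed

text \<open>An abstract echelon argument, with \<open>P p\<close> standing for the vanishing of the
  summand at \<open>p\<close>. Among the indices violating \<open>P\<close> take the one with the
  least key; its equation collapses to the diagonal term.\<close>

lemma triangular_sum_zero:
  fixes key :: "'i \<Rightarrow> 'k::linorder" and a :: "'i \<Rightarrow> 'i \<Rightarrow> 'a::comm_monoid_add"
  assumes fin: "finite L" and inj: "inj_on key L"
    and sum: "\<And>q. q \<in> L \<Longrightarrow> (\<Sum>p\<in>L. a q p) = 0"
    and tri: "\<And>p q. p \<in> L \<Longrightarrow> q \<in> L \<Longrightarrow> key q < key p \<Longrightarrow> a q p = 0"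
    and zero: "\<And>p q. p \<in> L \<Longrightarrow> q \<in> L \<Longrightarrow> P p \<Longrightarrow> a q p = 0"
    and diag: "\<And>q. q \<in> L \<Longrightarrow> a q q = 0 \<Longrightarrow> P q"
  shows "\<forall>p\<in>L. P p"
proof (rule ccontr)
  let ?N = "{p \<in> L. \<not> P p}"
  assume "\<not> ?thesis"
  then have N: "finite (key ` ?N)" "key ` ?N \<noteq> {}" using fin by auto
  obtain q where q: "q \<in> ?N" "key q = Min (key ` ?N)"
    using Min_in[OF N] by (metis (no_types, lifting) imageE)
  have qmin: "key q \<le> key p" if "p \<in> ?N" for p
    unfolding q(2) using N(1) that by (intro Min_le imageI)
  have "a q p = 0" if "p \<in> L - {q}" for p
  proof (cases "P p")
    case False
    then have "key q \<le> key p" "key q \<noteq> key p" using qmin q(1) that inj by (auto dest: inj_onD)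
    then show ?thesis using tri q that by auto
  qed (use zero q that in auto)
  then have "(\<Sum>p\<in>L. a q p) = a q q"
    using fin q sum.remove[of L q "a q"] by simp
  then show False using sum diag q by auto
qed

section \<open>Billiard arrays in an arbitrary vector space\<close>

context vector_space
begin

lemma one_dim_multiple:
  assumes "dim W = 1" "subspace W" "x \<in> W" "x \<noteq> 0" "y \<in> W"
  shows "\<exists>a. y = scale a x"
proof -
  obtain E where E: "E \<subseteq> W" "independent E" "W \<subseteq> span E" "card E = dim W"
    by (rule basis_exists)
  then obtain e where e: "E = {e}" using assms(1) by (auto simp: card_1_singleton_iff)
  obtain a b where ab: "x = scale a e" "y = scale b e"
    using subsetD[OF E(3) assms(3)] subsetD[OF E(3) assms(5)] unfolding e span_singleton by blast
  then have "a \<noteq> 0" using assms(4) by auto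
  then have "y = scale (b / a) x" using ab by simp
  then show ?thesis by blast
qed

lemma dim_span_singleton: "x \<noteq> 0 \<Longrightarrow> dim (span {x}) = 1"
  by (simp add: dim_span_eq_card_independent dependent_single del: dim_span)

lemma span_image_eq:
  assumes "finite A"
  shows "span (w ` A) = range (\<lambda>g. \<Sum>j\<in>A. scale (g j) (w j))"
proof
  show "span (w ` A) \<subseteq> range (\<lambda>g. \<Sum>j\<in>A. scale (g j) (w j))"
  proof (rule span_minimal)
    show "w ` A \<subseteq> range (\<lambda>g. \<Sum>j\<in>A. scale (g j) (w j))"
    proof
      fix x assume "x \<in> w ` A"
      then obtain i where i: "i \<in> A" "x = w i" by blast
      have "(\<Sum>j\<in>A. scale (if j = i then 1 else 0) (w j)) = (\<Sum>j\<in>A. if j = i then w j else 0)"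
        by (rule sum.cong) auto
      then have "x = (\<Sum>j\<in>A. scale (if j = i then 1 else 0) (w j))" using i assms by simp
      then show "x \<in> range (\<lambda>g. \<Sum>j\<in>A. scale (g j) (w j))"
        by (rule range_eqI[where x = "\<lambda>j. if j = i then 1 else 0"])
    qed
    show "subspace (range (\<lambda>g. \<Sum>j\<in>A. scale (g j) (w j)))"
    proof (rule subspaceI)
      show "0 \<in> range (\<lambda>g. \<Sum>j\<in>A. scale (g j) (w j))"
        by (rule range_eqI[where x = "\<lambda>_. 0"]) simp
    next
      fix x y
      assume "x \<in> range (\<lambda>g. \<Sum>j\<in>A. scale (g j) (w j))" "y \<in> range (\<lambda>g. \<Sum>j\<in>A. scale (g j) (w j))"
      then obtain g h where "x = (\<Sum>j\<in>A. scale (g j) (w j))" "y = (\<Sum>j\<in>A. scale (h j) (w j))"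
        by blast
      then show "x + y \<in> range (\<lambda>g. \<Sum>j\<in>A. scale (g j) (w j))"
        by (intro range_eqI[where x = "\<lambda>j. g j + h j"])
          (simp add: sum.distrib scale_left_distrib)
    next
      fix c x
      assume "x \<in> range (\<lambda>g. \<Sum>j\<in>A. scale (g j) (w j))"
      then obtain g where "x = (\<Sum>j\<in>A. scale (g j) (w j))" by blast
      then show "scale c x \<in> range (\<lambda>g. \<Sum>j\<in>A. scale (g j) (w j))"
        by (intro range_eqI[where x = "\<lambda>j. c * g j"]) (simp add: scale_sum_right)
    qed
  qed
  show "range (\<lambda>g. \<Sum>j\<in>A. scale (g j) (w j)) \<subseteq> span (w ` A)"
    by (intro image_subsetI span_sum span_scale span_base imageI)
qed

lemma independent_family_zero:
  assumes "inj_on w A" "independent (w ` A)" "finite A"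
    and "(\<Sum>j\<in>A. scale (f j) (w j)) = 0" "j \<in> A"
  shows "f j = 0"
proof -
  let ?f = "\<lambda>x. f (inv_into A w x)"
  have "(\<Sum>x\<in>w ` A. scale (?f x) x) = (\<Sum>j\<in>A. scale (f j) (w j))"
    using assms(1) by (simp add: sum.reindex)
  then have "?f (w j) = 0"
    using assms(3,4,5) by (intro independentD[OF assms(2), of "w ` A" ?f]) auto
  then show ?thesis using assms(1,5) by simp
qed

lemma billiard_array_subspace:
  assumes "billiard_array scale d V B" "p \<in> Delta (int d)"
  shows "subspace (B p)" "B p \<subseteq> V" "dim (B p) = 1"
  using assms unfolding billiard_array_def by (auto dest: PiE_mem)

lemma billiard_array_clique_disjoint:
  assumes BA: "billiard_array scale d V B" and C: "C \<in> black_cliques d"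
    and pq: "p \<in> C" "q \<in> C" "p \<noteq> q" and w: "w \<in> B p" "w \<in> B q"
  shows "w = 0"
proof -
  obtain L where L: "L \<in> lines d" "p \<in> L" "q \<in> L"
    using black_clique_line[OF C pq(1,2)] by blast
  have sub: "i \<in> L \<Longrightarrow> subspace (B i)" for i
    using billiard_array_subspace(1)[OF BA] line_subset_Delta[OF L(1)] by blast
  have "direct_family B L" using BA L by (simp add: billiard_array_def)
  then show ?thesis
    using finite_line[OF L(1)] L(2,3) pq(3) w(1)
  proof (rule direct_family_disjoint)
    show "- w \<in> B q" using sub[OF L(3)] w(2) by (rule subspace_neg)
    show "0 \<in> B i" if "i \<in> L" for i using sub[OF that] by (rule subspace_0)
  qed
qed

text \<open>A single pair \<open>x\<close>, \<open>y\<close> determines the map on all multiples of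
  \<open>x\<close>. Uniqueness holds because two candidates differ by an element of both
  \<open>B q\<close> and \<open>B n\<close>, which meet only in 0. For \<open>a = 0\<close> the
  value is the default 0 of \<open>Btilde\<close>.\<close>

lemma Btilde_scale:
  assumes BA: "billiard_array scale d V B" and C: "{p, q, n} \<in> black_cliques d"
    and ne: "p \<noteq> q" "q \<noteq> n" "p \<noteq> n"
    and sub: "subspace (B p)" "subspace (B q)" "subspace (B n)"
    and xy: "x \<in> B p" "y \<in> B q" "x + y \<in> B n" "x \<noteq> 0" "y \<noteq> 0"
  shows "Btilde d B p q (scale a x) = scale a y"
proof (cases "a = 0")
  case False
  have third: "third_loc d p q = n" using C ne by (rule third_locI)
  have "(THE y'. y' \<in> B q \<and> y' \<noteq> 0 \<and> scale a x + y' \<in> B n) = scale a y"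
  proof (rule the_equality)
    show "scale a y \<in> B q \<and> scale a y \<noteq> 0 \<and> scale a x + scale a y \<in> B n"
      using xy False subspace_scale[OF sub(2) xy(2)] subspace_scale[OF sub(3) xy(3), of a]
      by (simp add: scale_right_distrib)
  next
    fix y' assume y': "y' \<in> B q \<and> y' \<noteq> 0 \<and> scale a x + y' \<in> B n"
    have "y' - scale a y \<in> B q"
      using y' xy(2) sub(2) by (simp add: subspace_diff subspace_scale)
    moreover have "y' - scale a y \<in> B n"
      using subspace_diff[OF sub(3) conjunct2[OF conjunct2[OF y']] subspace_scale[OF sub(3) xy(3), of a]]
      by (simp add: scale_right_distrib)
    ultimately have "y' - scale a y = 0"
      using ne by (intro billiard_array_clique_disjoint[OF BA C, of q n]) auto
    then show "y' = scale a y" by simp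
  qed
  then show ?thesis using False xy(4) by (simp add: Btilde_def third)
qed (simp add: Btilde_def)

text \<open>Reduces a \<open>B\<close>-value to one closed chain \<open>x\<close>, \<open>y\<close>,
  \<open>z\<close>, \<open>scale c x\<close> around the triangle of \<lambda>, \<mu>, \<nu>. The
  three sums lie in the spaces that complete its edges to black cliques.\<close>

lemma B_value_eqI:
  assumes BA: "billiard_array scale d V B" and D: "(r, s, t) \<in> Delta (int d - 2)"
    and x: "x \<in> B (r, s + 1, t + 1)" "x \<noteq> 0"
    and y: "y \<in> B (r + 1, s, t + 1)" "y \<noteq> 0"
    and z: "z \<in> B (r + 1, s + 1, t)" "z \<noteq> 0"
    and xy: "x + y \<in> B (r, s, t + 2)"
    and yz: "y + z \<in> B (r + 2, s, t)"
    and zx: "z + scale c x \<in> B (r, s + 2, t)" "c \<noteq> 0"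
  shows "B_value scale d B (r, s, t) = c"
proof -
  let ?l = "(r, s + 1, t + 1)" and ?m = "(r + 1, s, t + 1)" and ?n = "(r + 1, s + 1, t)"
  have Delta: "?l \<in> Delta (int d)" "?m \<in> Delta (int d)" "?n \<in> Delta (int d)"
    "(r, s, t + 2) \<in> Delta (int d)" "(r + 2, s, t) \<in> Delta (int d)" "(r, s + 2, t) \<in> Delta (int d)"
    using D by (auto simp: Delta_def)
  note sub = Delta[THEN billiard_array_subspace(1)[OF BA]]
  have "{?l, ?m, (r, s, t + 2)} \<in> black_cliques d"
    using D by (intro black_cliqueI[of r s "t + 1"]) (simp_all add: Delta_def insert_commute add.commute)
  then have lm: "Btilde d B ?l ?m (scale a x) = scale a y" for a
    using x y xy sub by (intro Btilde_scale[OF BA, of ?l ?m "(r, s, t + 2)"]) simp_all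
  have "{?m, ?n, (r + 2, s, t)} \<in> black_cliques d"
    using D by (intro black_cliqueI[of "r + 1" s t]) (simp_all add: Delta_def insert_commute add.commute)
  then have mn: "Btilde d B ?m ?n (scale a y) = scale a z" for a
    using y z yz sub by (intro Btilde_scale[OF BA, of ?m ?n "(r + 2, s, t)"]) simp_all
  have "{?n, ?l, (r, s + 2, t)} \<in> black_cliques d"
    using D by (intro black_cliqueI[of r "s + 1" t]) (simp_all add: Delta_def insert_commute add.commute)
  then have nl: "Btilde d B ?n ?l (scale a z) = scale a (scale c x)" for a
    using x z zx sub subspace_scale[OF sub(1) x(1), of c]
    by (intro Btilde_scale[OF BA, of ?n ?l "(r, s + 2, t)"]) simp_all
  have cycle: "Btilde d B ?n ?l (Btilde d B ?m ?n (Btilde d B ?l ?m x')) = scale c x'"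
    if "x' \<in> B ?l" for x'
  proof -
    \<comment> \<open>The space at \<lambda> is one-dimensional, so following the multiples of
      \<open>x\<close> around the cycle covers all of it.\<close>
    obtain a where a: "x' = scale a x"
      using one_dim_multiple[OF billiard_array_subspace(3)[OF BA Delta(1)] sub(1) x \<open>x' \<in> B ?l\<close>] by blast
    show ?thesis unfolding a lm mn nl by (simp add: mult.commute)
  qed
  have "(THE c. \<forall>x\<in>B ?l. Btilde d B ?n ?l (Btilde d B ?m ?n (Btilde d B ?l ?m x)) = scale c x) = c"
  proof (rule the_equality)
    fix e assume "\<forall>x\<in>B ?l. Btilde d B ?n ?l (Btilde d B ?m ?n (Btilde d B ?l ?m x)) = scale e x"
    then have "scale e x = scale c x" using cycle[OF x(1)] x(1) by metis
    then show "e = c" using x(2) by simp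
  qed (use cycle in blast)
  then show ?thesis using D by (simp add: B_value_def)
qed

end

section \<open>Sums inside a black clique\<close>

text \<open>The spaces of a black clique are \<open>coords T d t s\<close>,
  \<open>coords T d (t + 1) s\<close> and \<open>coords T d t (s + 1)\<close>. This lemma and the
  next two take a sum over two of them into the third, by cancelling the coefficient at
  \<open>u s\<close>, at the last column or at the first column, respectively.\<close>

lemma coords_add_extend:
  assumes "g \<in> coords T d t s" "h \<in> coords T d (t + 1) s"
    and "row_app T d s g + row_app T d s h = 0"
  shows "(\<lambda>j. g j + h j) \<in> coords T d t (s + 1)"
  using assms by (auto simp: coords_def row_app_add less_Suc_eq)

lemma coords_add_drop_last:
  assumes "g \<in> coords T d (t + 1) s" "h \<in> coords T d t (s + 1)"
    and "g (t + s + 1) + h (t + s + 1) = 0"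
  shows "(\<lambda>j. g j + h j) \<in> coords T d t s"
proof -
  have "g j + h j = 0" if "t + s < j" for j
    using assms that by (cases "j = t + s + 1") (auto simp: coords_def)
  then show ?thesis using assms by (auto simp: coords_def row_app_add)
qed

lemma coords_add_drop_first:
  assumes "g \<in> coords T d t (s + 1)" "h \<in> coords T d t s" and "g t + h t = 0"
  shows "(\<lambda>j. g j + h j) \<in> coords T d (t + 1) s"
proof -
  have "g j + h j = 0" if "j < t + 1" for j
    using assms that by (cases "j = t") (auto simp: coords_def)
  then show ?thesis using assms by (auto simp: coords_def row_app_add)
qed

lemma Delta_natE:
  assumes "p \<in> Delta (int n)"
  obtains r s t where "p = (int r, int s, int t)" "r + s + t = n"
proof -
  obtain r s t where p: "p = (r, s, t)" by (cases p)
  with assms have "p = (int (nat r), int (nat s), int (nat t))" "nat r + nat s + nat t = n"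
    by (auto simp: Delta_def)
  then show ?thesis by (rule that)
qed

section \<open>Consequences of being very good and upper triangular\<close>

locale very_good_array = vector_space scale
  for scale :: "'a::field \<Rightarrow> 'v::ab_group_add \<Rightarrow> 'v" +
  fixes d :: nat and T :: "'a mat" and V :: "'v set" and u :: "nat \<Rightarrow> 'v"
  assumes T_carrier: "T \<in> carrier_mat (d + 1) (d + 1)"
    and T_upper: "upper_triangular T"
    and T_very_good: "very_good d T"
    and u_basis: "indexed_basis scale V d u"
begin

definition v :: "nat \<Rightarrow> 'v" where
  "v j = (\<Sum>i = 0..d. scale (T $$ (i, j)) (u i))"

definition comb :: "(nat \<Rightarrow> 'a) \<Rightarrow> 'v" where
  "comb g = (\<Sum>j = 0..d. scale (g j) (v j))"

lemma D_map_minor: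
  assumes "r + s + t = d"
  shows "D_map d T (int r, int s, int t) = minor T t (s + 1)"
proof -
  have "d - r - t = s" using assms by simp
  then show ?thesis
    using assms by (simp add: D_map_def Delta_def top_submat_def minor_def)
qed

lemma minor_nonzero:
  assumes "t + n \<le> d + 1"
  shows "minor T t n \<noteq> 0"
proof (cases n)
  case (Suc s)
  \<comment> \<open>The location at which \<open>D_map d T\<close> takes this minor as its value;
    very goodness makes that value nonzero.\<close>
  let ?p = "(int (d - s - t), int s, int t)"
  have "?p \<in> Delta (int d)" using assms Suc by (auto simp: Delta_def)
  then have "D_map d T ?p \<noteq> 0"
    using PiE_mem[OF D_map_in_VF[OF T_very_good, unfolded VF_def]] by blast
  moreover have "D_map d T ?p = minor T t (s + 1)"
    using assms Suc by (intro D_map_minor) auto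
  ultimately show ?thesis using Suc by simp
qed simp

lemma T_lower: "j < i \<Longrightarrow> i \<le> d \<Longrightarrow> T $$ (i, j) = 0"
  using T_upper T_carrier by auto

text \<open>The whole matrix is \<open>T[0,d]\<close>, and its nonzero determinant is the product of
  the diagonal entries.\<close>

lemma T_diag_nonzero:
  assumes "i \<le> d"
  shows "T $$ (i, i) \<noteq> 0"
proof
  assume "T $$ (i, i) = 0"
  then have "0 \<in> set (diag_mat T)"
    using assms T_carrier by (auto simp: diag_mat_def simp del: upt_Suc intro!: rev_image_eqI[of i])
  then have "det T = 0"
    using det_upper_triangular[OF T_upper T_carrier] by (simp add: prod_list_zero_iff)
  moreover have "mat (d + 1) (d + 1) (\<lambda>(a, b). T $$ (a, 0 + b)) = T"
    using T_carrier by (intro eq_matI) auto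
  ultimately show False
    using minor_nonzero[of 0 "d + 1"] by (simp add: minor_def)
qed

text \<open>Row \<open>j\<close> starts at column \<open>j\<close>, where \<open>g\<close> ends, so
  a single product survives.\<close>

lemma row_app_leading:
  assumes "j \<le> d" "\<And>l. j < l \<Longrightarrow> g l = 0"
  shows "row_app T d j g = T $$ (j, j) * g j"
proof -
  have "row_app T d j g = (\<Sum>l\<in>{j}. T $$ (j, l) * g l)"
    unfolding row_app_def
  proof (intro sum.mono_neutral_right ballI)
    fix l assume "l \<in> {0..d} - {j}"
    then show "T $$ (j, l) * g l = 0"
      using assms T_lower[of l j] by (cases "l < j") auto
  qed (use assms in auto)
  then show ?thesis by simp
qed

text \<open>In terms of spaces: \<open>u 0, ..., u k\<close> and \<open>v 0, ..., v k\<close> span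
  the same subspace. If \<open>g\<close> had a nonzero entry beyond \<open>k\<close>, the row of the
  last such entry would give a diagonal entry times that entry, which is nonzero.\<close>

lemma row_app_tail_zero_iff:
  assumes supp: "\<And>j. d < j \<Longrightarrow> g j = 0"
  shows "(\<forall>i. k < i \<and> i \<le> d \<longrightarrow> row_app T d i g = 0) \<longleftrightarrow> (\<forall>j>k. g j = 0)"
proof
  assume rows: "\<forall>i. k < i \<and> i \<le> d \<longrightarrow> row_app T d i g = 0"
  show "\<forall>j>k. g j = 0"
  proof (rule ccontr)
    let ?J = "{j. k < j \<and> g j \<noteq> 0}"
    assume "\<not> (\<forall>j>k. g j = 0)"
    then have ne: "?J \<noteq> {}" by blast
    have "?J \<subseteq> {..d}" using supp by (auto simp: not_less[symmetric])
    then have fin: "finite ?J" by (rule finite_subset) simp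
    define j where "j = Max ?J"
    have j: "k < j" "g j \<noteq> 0" using Max_in[OF fin ne] unfolding j_def by auto
    have "g l = 0" if "j < l" for l
      using that j(1) Max_ge[OF fin, of l] unfolding j_def[symmetric] by fastforce
    moreover have "j \<le> d" using j supp not_less by blast
    ultimately show False using row_app_leading[of j g] rows j T_diag_nonzero by simp
  qed
next
  assume tail: "\<forall>j>k. g j = 0"
  show "\<forall>i. k < i \<and> i \<le> d \<longrightarrow> row_app T d i g = 0"
    using tail by (auto simp: row_app_leading)
qed

section \<open>The array in coordinates\<close>

lemma comb_add: "comb (\<lambda>j. g j + h j) = comb g + comb h"
  by (simp add: comb_def scale_left_distrib sum.distrib)

lemma comb_scale: "comb (\<lambda>j. c * g j) = scale c (comb g)"
  by (simp add: comb_def scale_sum_right)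

lemma comb_0: "comb (\<lambda>_. 0) = 0"
  by (simp add: comb_def)

lemma comb_sum: "comb (\<lambda>j. \<Sum>p\<in>L. g p j) = (\<Sum>p\<in>L. comb (g p))"
  unfolding comb_def scale_sum_left by (rule sum.swap)

lemma comb_u: "comb g = (\<Sum>i = 0..d. scale (row_app T d i g) (u i))"
proof -
  have "comb g = (\<Sum>j = 0..d. \<Sum>i = 0..d. scale (T $$ (i, j) * g j) (u i))"
    by (simp add: comb_def v_def scale_sum_right mult.commute)
  also have "\<dots> = (\<Sum>i = 0..d. \<Sum>j = 0..d. scale (T $$ (i, j) * g j) (u i))"
    by (rule sum.swap)
  finally show ?thesis by (simp add: row_app_def scale_sum_left)
qed

lemma u_facts: "inj_on u {0..d}" "independent (u ` {0..d})" "span (u ` {0..d}) = V"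
  using u_basis by (auto simp: indexed_basis_def)

lemma comb_in_V: "comb g \<in> V"
  unfolding comb_u u_facts(3)[symmetric] by (intro span_sum span_scale span_base imageI)

text \<open>The vectors \<open>v 0, ..., v d\<close> are independent: independence of the
  \<open>u i\<close> makes every row vanish on \<open>g\<close>, and \<open>T\<close> is invertible.
  The support condition fixes the entries that \<open>comb\<close> does not see.\<close>

lemma comb_eq_0:
  assumes supp: "\<And>j. d < j \<Longrightarrow> g j = 0" and "comb g = 0"
  shows "g = (\<lambda>_. 0)"
proof -
  have rows: "row_app T d i g = 0" if "i \<le> d" for i
    using independent_family_zero[OF u_facts(1,2), of "\<lambda>i. row_app T d i g" i]
      assms(2) that by (simp add: comb_u)
  \<comment> \<open>For \<open>t = 0\<close> and \<open>s = d\<close> the window is the full range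
    of columns, and row \<open>d\<close> is the remaining row functional.\<close>
  have "g \<in> coords T d 0 d" using supp rows by (auto simp: coords_def)
  then show ?thesis using rows by (rule coords_eq_zeroI) (auto simp: minor_nonzero)
qed

lemma comb_in_span_u_iff:
  assumes "A \<subseteq> {0..d}"
  shows "comb g \<in> span (u ` A) \<longleftrightarrow> (\<forall>i\<in>{0..d} - A. row_app T d i g = 0)"
proof
  have fin: "finite A" using assms by (rule finite_subset) simp
  assume "comb g \<in> span (u ` A)"
  then obtain h where "comb g = (\<Sum>j\<in>A. scale (h j) (u j))"
    unfolding span_image_eq[OF fin] by blast
  also have "\<dots> = (\<Sum>j\<in>{0..d}. scale (if j \<in> A then h j else 0) (u j))"
    using assms by (intro sum.mono_neutral_cong_left) auto
  finally have "(\<Sum>j\<in>{0..d}. scale (row_app T d j g - (if j \<in> A then h j else 0)) (u j)) = 0"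
    by (simp add: comb_u scale_left_diff_distrib sum_subtractf)
  from independent_family_zero[OF u_facts(1,2) _ this]
  show "\<forall>i\<in>{0..d} - A. row_app T d i g = 0" by force
next
  assume zero: "\<forall>i\<in>{0..d} - A. row_app T d i g = 0"
  have "comb g = (\<Sum>i\<in>A. scale (row_app T d i g) (u i))"
    unfolding comb_u using assms zero by (intro sum.mono_neutral_right) auto
  then show "comb g \<in> span (u ` A)"
    by (auto intro: span_sum span_scale span_base)
qed

lemma span_v:
  assumes "A \<subseteq> {0..d}"
  shows "span (v ` A) = comb ` {g. \<forall>j. j \<notin> A \<longrightarrow> g j = 0}"
proof -
  have fin: "finite A" using assms by (rule finite_subset) simp
  have eq: "comb g = (\<Sum>j\<in>A. scale (h j) (v j))"
    if "\<And>j. j \<in> A \<Longrightarrow> g j = h j" "\<And>j. j \<notin> A \<Longrightarrow> g j = 0" for g h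
    unfolding comb_def using assms that by (intro sum.mono_neutral_cong_right) auto
  show ?thesis
  proof (intro subset_antisym subsetI)
    fix x assume "x \<in> span (v ` A)"
    then obtain h where "x = (\<Sum>j\<in>A. scale (h j) (v j))"
      unfolding span_image_eq[OF fin] by blast
    then have "x = comb (\<lambda>j. if j \<in> A then h j else 0)" by (subst eq[of _ h]) auto
    moreover have "(\<lambda>j. if j \<in> A then h j else 0) \<in> {g. \<forall>j. j \<notin> A \<longrightarrow> g j = 0}" by simp
    ultimately show "x \<in> comb ` {g. \<forall>j. j \<notin> A \<longrightarrow> g j = 0}" by blast
  next
    fix x assume "x \<in> comb ` {g. \<forall>j. j \<notin> A \<longrightarrow> g j = 0}"
    then obtain g where "x = comb g" "\<And>j. j \<notin> A \<Longrightarrow> g j = 0" by blast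
    then have "x = (\<Sum>j\<in>A. scale (g j) (v j))" using eq[of g g] by simp
    then show "x \<in> span (v ` A)" unfolding span_image_eq[OF fin] by blast
  qed
qed

text \<open>Each of the three spans contributes one condition on \<open>g\<close>: the
  \<open>v\<close>-span bounds the window from below, the second \<open>u\<close>-span annihilates
  the rows below \<open>s\<close>, and the first \<open>u\<close>-span, by triangularity, bounds the
  window from above at \<open>s + t = d - r\<close>.\<close>

lemma mat_array_eq:
  assumes "r + s + t = d"
  shows "mat_array scale d u T (int r, int s, int t) = comb ` coords T d t s"
proof -
  have idx: "d - nat (int r) = s + t" "d - (d - nat (int s)) = s" "d - (d - nat (int t)) = t"
    using assms by auto
  have "mat_array scale d u T (int r, int s, int t) =
      span (u ` {0..s + t}) \<inter> span (u ` {s..d}) \<inter> span (v ` {t..d})"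
    using assms unfolding mat_array_def Let_def
    by (simp add: Delta_def idx v_def[abs_def] del: nat_int diff_diff_cancel)
  also have "\<dots> = comb ` coords T d t s"
  proof (intro subset_antisym subsetI)
    fix x assume x: "x \<in> span (u ` {0..s + t}) \<inter> span (u ` {s..d}) \<inter> span (v ` {t..d})"
    then obtain g where g: "x = comb g" "\<And>j. j \<notin> {t..d} \<Longrightarrow> g j = 0"
      using span_v[of "{t..d}"] by auto
    have "\<forall>i. s + t < i \<and> i \<le> d \<longrightarrow> row_app T d i g = 0"
      using x comb_in_span_u_iff[of "{0..s + t}" g] assms unfolding g(1) by auto
    then have "\<forall>j>s + t. g j = 0"
      using row_app_tail_zero_iff[of g "s + t"] g(2) by simp
    moreover have "\<forall>i<s. row_app T d i g = 0"
      using x comb_in_span_u_iff[of "{s..d}" g] assms unfolding g(1) by auto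
    ultimately have "g \<in> coords T d t s" using g(2) by (auto simp: coords_def)
    then show "x \<in> comb ` coords T d t s" using g(1) by blast
  next
    fix x assume "x \<in> comb ` coords T d t s"
    then obtain g where g: "x = comb g" "g \<in> coords T d t s" by blast
    then have supp: "g j = 0" if "j < t \<or> t + s < j" for j using that by (auto simp: coords_def)
    have "\<forall>i. s + t < i \<and> i \<le> d \<longrightarrow> row_app T d i g = 0"
      using row_app_tail_zero_iff[of g "s + t"] supp assms by simp
    then have "x \<in> span (u ` {0..s + t})"
      using comb_in_span_u_iff[of "{0..s + t}" g] assms g(1) by auto
    moreover have "x \<in> span (u ` {s..d})"
      using comb_in_span_u_iff[of "{s..d}" g] g by (auto simp: coords_def)
    moreover have "x \<in> span (v ` {t..d})"
      using span_v[of "{t..d}"] supp assms g(1) by auto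
    ultimately show "x \<in> span (u ` {0..s + t}) \<inter> span (u ` {s..d}) \<inter> span (v ` {t..d})"
      by blast
  qed
  finally show ?thesis .
qed

section \<open>The axioms of a Billiard Array\<close>

text \<open>The generator has last coefficient \<open>minor T t s\<close>, which is nonzero, so that
  coefficient detects the multiple.\<close>

lemma coords_last_eq_zeroI:
  assumes "g \<in> coords T d t s" "g (t + s) = 0" "t + s \<le> d"
  shows "g = (\<lambda>_. 0)"
proof -
  obtain c where "g = (\<lambda>j. c * cofactor_coords T t s j)"
    using coords_eq_multiple[OF assms(1) _ assms(3)] minor_nonzero assms(3) by auto
  then show ?thesis
    using assms(2,3) minor_nonzero[of t s] by (auto simp: cofactor_coords_last)
qed

lemma comb_cofactor_coords_nonzero:
  assumes "t + s \<le> d"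
  shows "comb (cofactor_coords T t s) \<noteq> 0"
proof
  assume "comb (cofactor_coords T t s) = 0"
  then have "cofactor_coords T t s = (\<lambda>_. 0)"
    using assms by (intro comb_eq_0) (auto simp: cofactor_coords_def)
  then have "cofactor_coords T t s (t + s) = 0" by simp
  then show False using assms minor_nonzero[of t s] by (simp add: cofactor_coords_last)
qed

lemma comb_coords_span:
  assumes "t + s \<le> d"
  shows "comb ` coords T d t s = span {comb (cofactor_coords T t s)}"
  unfolding span_singleton
proof (intro subset_antisym image_subsetI)
  fix g assume "g \<in> coords T d t s"
  then obtain c where "g = (\<lambda>j. c * cofactor_coords T t s j)"
    using coords_eq_multiple minor_nonzero assms by fastforce
  then show "comb g \<in> range (\<lambda>k. scale k (comb (cofactor_coords T t s)))"
    by (auto simp: comb_scale)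
next
  fix c :: 'a
  show "scale c (comb (cofactor_coords T t s)) \<in> comb ` coords T d t s"
    using comb_scale[of c "cofactor_coords T t s", symmetric]
      coords_scale[OF cofactor_coords_mem[OF assms], of c] by blast
qed

lemma direct_family_line:
  assumes L: "L \<in> lines d"
  shows "direct_family (mat_array scale d u T) L"
  unfolding direct_family_def
proof (intro allI impI, elim conjE)
  fix x :: "loc \<Rightarrow> 'v"
  assume x: "\<forall>p\<in>L. x p \<in> mat_array scale d u T p" and sum: "(\<Sum>p\<in>L. x p) = 0"
  let ?r = "\<lambda>p :: loc. nat (fst p)" and ?s = "\<lambda>p :: loc. nat (fst (snd p))"
    and ?t = "\<lambda>p :: loc. nat (snd (snd p))"
  have dims: "?r p + ?s p + ?t p = d" "fst p = int (?r p)" "fst (snd p) = int (?s p)"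
    "snd (snd p) = int (?t p)" if "p \<in> L" for p
    using line_subset_Delta[OF L] that by (auto simp: Delta_def)
  have loc: "0 \<le> fst p" "0 \<le> fst (snd p)" "fst p + fst (snd p) + snd (snd p) = int d" if "p \<in> L" for p
    using line_subset_Delta[OF L] that by (auto simp: Delta_def)
  have "\<exists>g. g \<in> coords T d (?t p) (?s p) \<and> x p = comb g" if "p \<in> L" for p
  proof -
    have "p = (int (?r p), int (?s p), int (?t p))"
      using dims(2-4)[OF that] by (simp add: prod_eq_iff)
    then have "x p \<in> comb ` coords T d (?t p) (?s p)"
      using x that mat_array_eq[OF dims(1)[OF that]] by metis
    then show ?thesis by blast
  qed
  then obtain g where g: "\<And>p. p \<in> L \<Longrightarrow> g p \<in> coords T d (?t p) (?s p)"
    and xg: "\<And>p. p \<in> L \<Longrightarrow> x p = comb (g p)"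
    by metis
  have supp: "g p j = 0" if "p \<in> L" "?t p + ?s p < j" for p j
    using g[OF that(1)] that(2) by (simp add: coords_def)
  \<comment> \<open>Independence of the \<open>v j\<close> turns the vanishing sum of vectors into
    one scalar relation for each column.\<close>
  have "(\<lambda>j. \<Sum>p\<in>L. g p j) = (\<lambda>_. 0)"
  proof (rule comb_eq_0)
    show "comb (\<lambda>j. \<Sum>p\<in>L. g p j) = 0" using sum by (simp add: comb_sum xg)
    show "(\<Sum>p\<in>L. g p j) = 0" if "d < j" for j
    proof (intro sum.neutral ballI)
      fix p assume p: "p \<in> L"
      then show "g p j = 0" using supp[OF p, of j] dims(1)[OF p] that by linarith
    qed
  qed
  then have gsum: "(\<Sum>p\<in>L. g p j) = 0" for j by (rule fun_cong)
  from L obtain c where c: "(\<forall>p\<in>L. fst p = c) \<or> (\<forall>p\<in>L. fst (snd p) = c) \<or> (\<forall>p\<in>L. snd (snd p) = c)"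
    unfolding lines_def by fastforce
  \<comment> \<open>On a line with constant \<open>r\<close> the lowest \<open>u\<close>-index \<open>s\<close> varies, on all other lines the highest
    index \<open>d - r\<close> varies; either way the spaces are in echelon form.\<close>
  have "\<forall>p\<in>L. g p = (\<lambda>_. 0)"
  proof (cases "\<forall>p\<in>L. fst p = c")
    case True
    show ?thesis
    proof (rule triangular_sum_zero[where key = ?s and a = "\<lambda>q p. row_app T d (?s q) (g p)"])
      show "inj_on ?s L"
      proof (rule inj_onI)
        fix p q assume pq: "p \<in> L" "q \<in> L" "?s p = ?s q"
        then show "p = q"
          using loc[OF pq(1)] loc[OF pq(2)] True by (auto simp: prod_eq_iff eq_nat_nat_iff)
      qed
      show "(\<Sum>p\<in>L. row_app T d (?s q) (g p)) = 0" for q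
        unfolding row_app_sum[symmetric] gsum by (simp add: row_app_def)
      show "row_app T d (?s q) (g p) = 0" if "p \<in> L" "?s q < ?s p" for p q
        using g[OF that(1)] that(2) by (simp add: coords_def)
      show "row_app T d (?s q) (g p) = 0" if "g p = (\<lambda>_. 0)" for p q
        using that by (simp add: row_app_def)
      show "g q = (\<lambda>_. 0)" if "q \<in> L" "row_app T d (?s q) (g q) = 0" for q
        using dims(1)[OF that(1)] by (intro coords_eq_zeroI[OF g[OF that(1)] that(2)] minor_nonzero) simp_all
    qed (rule finite_line[OF L])
  next
    case False
    with c have c: "(\<forall>p\<in>L. fst (snd p) = c) \<or> (\<forall>p\<in>L. snd (snd p) = c)" by blast
    show ?thesis
    proof (rule triangular_sum_zero[where key = ?r and a = "\<lambda>q p. g p (?t q + ?s q)"])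
      show "inj_on ?r L"
      proof (rule inj_onI)
        fix p q assume pq: "p \<in> L" "q \<in> L" "?r p = ?r q"
        then show "p = q"
          using loc[OF pq(1)] loc[OF pq(2)] c by (auto simp: prod_eq_iff eq_nat_nat_iff)
      qed
      show "(\<Sum>p\<in>L. g p (?t q + ?s q)) = 0" for q by (rule gsum)
      show "g p (?t q + ?s q) = 0" if pq: "p \<in> L" "q \<in> L" "?r q < ?r p" for p q
        using dims(1)[OF pq(1)] dims(1)[OF pq(2)] pq(3) by (intro supp[OF pq(1)]) linarith
      show "g q = (\<lambda>_. 0)" if "q \<in> L" "g q (?t q + ?s q) = 0" for q
        using dims(1)[OF that(1)] by (intro coords_last_eq_zeroI[OF g[OF that(1)] that(2)]) simp
    qed (use finite_line[OF L] in auto)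
  qed
  then show "\<forall>p\<in>L. x p = 0" by (simp add: xg comb_0)
qed

text \<open>Two of the three generators have a combination lying in the third space; moving it to
  the other side gives a nontrivial relation.\<close>

lemma not_direct_family_clique:
  assumes "C \<in> black_cliques d"
  shows "\<not> direct_family (mat_array scale d u T) C"
proof
  assume dir: "direct_family (mat_array scale d u T) C"
  obtain a' b' c' where C': "C = {(a' + 1, b', c'), (a', b' + 1, c'), (a', b', c' + 1)}"
    "(a', b', c') \<in> Delta (int d - 1)"
    using assms unfolding black_cliques_def by blast
  then have "d \<ge> 1" by (auto simp: Delta_def)
  then have "(a', b', c') \<in> Delta (int (d - 1))" using C'(2) by (simp add: of_nat_diff)
  then obtain a b c where abc: "(a', b', c') = (int a, int b, int c)" "a + b + c = d - 1"
    by (rule Delta_natE)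
  let ?p1 = "(int (a + 1), int b, int c)" and ?p2 = "(int a, int (b + 1), int c)"
    and ?p3 = "(int a, int b, int (c + 1))"
  have C: "C = {?p1, ?p2, ?p3}" using C'(1) abc(1) by (simp add: add.commute)
  have sum_d: "a + 1 + b + c = d" "a + (b + 1) + c = d" "a + b + (c + 1) = d"
    using abc(2) \<open>d \<ge> 1\<close> by auto
  note arr = sum_d[THEN mat_array_eq]
  \<comment> \<open>Row \<open>b\<close> takes the values \<open>minor T c (b + 1)\<close> and
    \<open>minor T (c + 1) (b + 1)\<close> on the two cofactor vectors; multiplying crosswise, with
    one sign changed, cancels the coefficient at \<open>u b\<close>.\<close>
  let ?g = "\<lambda>j. minor T (c + 1) (b + 1) * cofactor_coords T c b j"
  let ?h = "\<lambda>j. - minor T c (b + 1) * cofactor_coords T (c + 1) b j"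
  have g: "?g \<in> coords T d c b"
    by (intro coords_scale cofactor_coords_mem) (use sum_d in simp)
  have h: "?h \<in> coords T d (c + 1) b"
    by (intro coords_scale cofactor_coords_mem) (use sum_d in simp)
  have gh: "(\<lambda>j. ?g j + ?h j) \<in> coords T d c (b + 1)"
  proof (rule coords_add_extend[OF g h])
    show "row_app T d b ?g + row_app T d b ?h = 0"
      unfolding row_app_scale using sum_d by (simp add: row_app_cofactor_coords)
  qed
  let ?x = "\<lambda>p. if p = ?p1 then comb ?g else if p = ?p3 then comb ?h
     else scale (- 1) (comb (\<lambda>j. ?g j + ?h j))"
  have "scale (- 1) (comb (\<lambda>j. ?g j + ?h j)) \<in> mat_array scale d u T ?p2"
    unfolding arr comb_scale[symmetric] by (intro imageI coords_scale gh)
  then have "\<forall>p\<in>C. ?x p \<in> mat_array scale d u T p"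
    unfolding C using g h arr by auto
  moreover have "(\<Sum>p\<in>C. ?x p) = 0"
    unfolding C comb_add by simp
  ultimately have "?x ?p1 = 0"
    using dir[unfolded direct_family_def, THEN spec, of ?x] C by blast
  then have "scale (minor T (c + 1) (b + 1)) (comb (cofactor_coords T c b)) = 0"
    by (simp add: comb_scale)
  then show False
    using minor_nonzero[of "c + 1" "b + 1"] comb_cofactor_coords_nonzero[of c b] sum_d by simp
qed

lemma subspace_V: "subspace V"
  unfolding u_facts(3)[symmetric] by (rule subspace_span)

lemma billiard_mat_array: "billiard_array scale d V (mat_array scale d u T)"
  unfolding billiard_array_def
proof (intro conjI ballI)
  show "subspace V" by (rule subspace_V)
  have "dim V = card (u ` {0..d})"
    unfolding u_facts(3)[symmetric] by (rule dim_span_eq_card_independent[OF u_facts(2)])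
  then show "dim V = d + 1" using card_image[OF u_facts(1)] by simp
  show "mat_array scale d u T \<in> Delta (int d) \<rightarrow>\<^sub>E {W. subspace W \<and> W \<subseteq> V \<and> dim W = 1}"
  proof (rule PiE_I)
    fix p assume "p \<in> Delta (int d)"
    then obtain r s t where p: "p = (int r, int s, int t)" "r + s + t = d" by (rule Delta_natE)
    have st: "t + s \<le> d" using p by simp
    have eq: "mat_array scale d u T p = comb ` coords T d t s"
      unfolding p(1) by (rule mat_array_eq[OF p(2)])
    have "comb ` coords T d t s \<subseteq> V" using comb_in_V by blast
    moreover have "subspace (comb ` coords T d t s)" "dim (comb ` coords T d t s) = 1"
      unfolding comb_coords_span[OF st]
      using comb_cofactor_coords_nonzero[OF st] by (simp_all add: dim_span_singleton del: dim_span)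
    ultimately show "mat_array scale d u T p \<in> {W. subspace W \<and> W \<subseteq> V \<and> dim W = 1}"
      unfolding eq by blast
  qed (simp add: mat_array_def)
qed (use direct_family_line not_direct_family_clique in auto)

section \<open>The cycle defining the value, and its invariance\<close>

lemma mat_array_cycle:
  assumes d: "r + s + t + 2 = d"
  defines "c \<equiv> minor T (t + 2) (s + 1) * minor T (t + 1) s * minor T t (s + 2) /
    (minor T (t + 2) s * minor T t (s + 1) * minor T (t + 1) (s + 2))"
  obtains x y z where
    "x \<in> mat_array scale d u T (int r, int s + 1, int t + 1)" "x \<noteq> 0"
    "y \<in> mat_array scale d u T (int r + 1, int s, int t + 1)" "y \<noteq> 0"
    "z \<in> mat_array scale d u T (int r + 1, int s + 1, int t)" "z \<noteq> 0"
    "x + y \<in> mat_array scale d u T (int r, int s, int t + 2)"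
    "y + z \<in> mat_array scale d u T (int r + 2, int s, int t)"
    "z + scale c x \<in> mat_array scale d u T (int r, int s + 2, int t)"
proof -
  \<comment> \<open>The scalars are forced by the cancellations. \<open>k\<close> cancels the
    coefficient at \<open>v (t + 1)\<close> in \<open>x + y\<close>, where the cofactor signs for
    \<open>s + 1\<close> and \<open>s\<close> are opposite. \<open>l\<close> cancels the one at
    \<open>v (t + s + 1)\<close> in \<open>y + z\<close>. Then \<open>c\<close> is the scalar
    cancelling the one at \<open>u (s + 1)\<close> in \<open>z + scale c x\<close>.\<close>
  define k where "k = minor T (t + 2) (s + 1) / minor T (t + 2) s"
  define l where "l = - k * minor T (t + 1) s / minor T t (s + 1)"
  let ?x = "cofactor_coords T (t + 1) (s + 1)"
    and ?y = "\<lambda>j. k * cofactor_coords T (t + 1) s j"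
    and ?z = "\<lambda>j. l * cofactor_coords T t (s + 1) j"
  have nz: "minor T (t + 2) (s + 1) \<noteq> 0" "minor T (t + 2) s \<noteq> 0" "minor T (t + 1) s \<noteq> 0"
    "minor T t (s + 1) \<noteq> 0" "minor T (t + 1) (s + 2) \<noteq> 0" "minor T t (s + 2) \<noteq> 0"
    using d by (auto intro!: minor_nonzero)
  have kl: "k \<noteq> 0" "l \<noteq> 0" using nz by (auto simp: k_def l_def)
  have x: "?x \<in> coords T d (t + 1) (s + 1)" and y: "?y \<in> coords T d (t + 1) s"
    and z: "?z \<in> coords T d t (s + 1)"
    using d by (auto intro!: coords_scale cofactor_coords_mem)
  have xy: "(\<lambda>j. ?x j + ?y j) \<in> coords T d (t + 1 + 1) s"
  proof (rule coords_add_drop_first[OF x y])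
    show "?x (t + 1) + ?y (t + 1) = 0"
      using nz unfolding cofactor_coords_first by (simp add: k_def)
  qed
  have yz: "(\<lambda>j. ?y j + ?z j) \<in> coords T d t s"
  proof (rule coords_add_drop_last[OF y z])
    show "?y (t + s + 1) + ?z (t + s + 1) = 0"
      using nz cofactor_coords_last[of T "t + 1" s] cofactor_coords_last[of T t "s + 1"]
      by (simp add: l_def)
  qed
  have cx: "(\<lambda>j. c * ?x j) \<in> coords T d (t + 1) (s + 1)" by (rule coords_scale[OF x])
  have zx: "(\<lambda>j. ?z j + c * ?x j) \<in> coords T d t (s + 1 + 1)"
  proof (rule coords_add_extend[OF z cx])
    have "row_app T d (s + 1) ?z = l * minor T t (s + 2)"
      "row_app T d (s + 1) (\<lambda>j. c * ?x j) = c * minor T (t + 1) (s + 2)"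
      using d by (simp_all add: row_app_scale row_app_cofactor_coords)
    then show "row_app T d (s + 1) ?z + row_app T d (s + 1) (\<lambda>j. c * ?x j) = 0"
      using nz by (simp add: c_def l_def k_def)
  qed
  have arr: "mat_array scale d u T (int r, int s + 1, int t + 1) = comb ` coords T d (t + 1) (s + 1)"
    "mat_array scale d u T (int r + 1, int s, int t + 1) = comb ` coords T d (t + 1) s"
    "mat_array scale d u T (int r + 1, int s + 1, int t) = comb ` coords T d t (s + 1)"
    "mat_array scale d u T (int r, int s, int t + 2) = comb ` coords T d (t + 1 + 1) s"
    "mat_array scale d u T (int r + 2, int s, int t) = comb ` coords T d t s"
    "mat_array scale d u T (int r, int s + 2, int t) = comb ` coords T d t (s + 1 + 1)"
    using d mat_array_eq[of r "s + 1" "t + 1"] mat_array_eq[of "r + 1" s "t + 1"]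
      mat_array_eq[of "r + 1" "s + 1" t] mat_array_eq[of r s "t + 2"]
      mat_array_eq[of "r + 2" s t] mat_array_eq[of r "s + 2" t]
    by (simp_all add: add.commute)
  have ne: "comb ?x \<noteq> 0" "comb ?y \<noteq> 0" "comb ?z \<noteq> 0"
    using kl d by (simp_all add: comb_scale comb_cofactor_coords_nonzero)
  show ?thesis
  proof (rule that[of "comb ?x" "comb ?y" "comb ?z"])
    show "comb ?x + comb ?y \<in> mat_array scale d u T (int r, int s, int t + 2)"
      unfolding arr comb_add[symmetric] by (intro imageI xy)
    show "comb ?y + comb ?z \<in> mat_array scale d u T (int r + 2, int s, int t)"
      unfolding arr comb_add[symmetric] by (intro imageI yz)
    show "comb ?z + scale c (comb ?x) \<in> mat_array scale d u T (int r, int s + 2, int t)"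
      unfolding arr comb_scale[symmetric] comb_add[symmetric] by (intro imageI zx)
  qed (use x y z ne in \<open>auto simp: arr\<close>)
qed

text \<open>The six neighbours of \<open>(r + 1, s, t + 1)\<close> are matched with the six minors
  of the cycle.\<close>

lemma w_map_eq:
  assumes d: "r + s + t + 2 = d"
  shows "w_map d (D_map d T) (int r, int s, int t) =
    minor T (t + 2) (s + 1) * minor T (t + 1) s * minor T t (s + 2) /
    (minor T (t + 2) s * minor T t (s + 1) * minor T (t + 1) (s + 2))"
proof -
  let ?g = "ext_one (int d) (D_map d T)"
  have g: "?g (int r', int s', int t') = minor T t' (s' + 1)" if "r' + s' + t' = d" for r' s' t'
    using that D_map_minor[OF that] by (auto simp: ext_one_def Delta_def)
  \<comment> \<open>The entries sum to \<open>d + 1\<close> since the location carries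
    \<open>s' - 1\<close>. For \<open>s' = 0\<close> it leaves the grid, and the default 1 of
    \<open>ext_one\<close> agrees with the empty minor.\<close>
  have g': "?g (int r', int s' - 1, int t') = minor T t' s'" if "r' + s' + t' = d + 1" for r' s' t'
  proof (cases s')
    case 0
    then show ?thesis by (simp add: ext_one_def Delta_def)
  next
    case (Suc n)
    then show ?thesis using g[of r' n t'] that by simp
  qed
  have vals: "?g (int r + 2, int s - 1, int t + 1) = minor T (t + 1) s"
    "?g (int r + 1, int s + 1, int t) = minor T t (s + 2)"
    "?g (int r, int s, int t + 2) = minor T (t + 2) (s + 1)"
    "?g (int r, int s + 1, int t + 1) = minor T (t + 1) (s + 2)"
    "?g (int r + 1, int s - 1, int t + 2) = minor T (t + 2) s"
    "?g (int r + 2, int s, int t) = minor T t (s + 1)"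
    using d g'[of "r + 2" s "t + 1"] g[of "r + 1" "s + 1" t] g[of r s "t + 2"]
      g[of r "s + 1" "t + 1"] g'[of "r + 1" s "t + 2"] g[of "r + 2" s t]
    by (simp_all add: add.commute)
  have "(int r, int s, int t) \<in> Delta (int d - 2)" using d by (auto simp: Delta_def)
  moreover have "(int r + 1, int s, int t + 1) + dir_alpha = (int r + 2, int s - 1, int t + 1)"
    "(int r + 1, int s, int t + 1) + dir_beta = (int r + 1, int s + 1, int t)"
    "(int r + 1, int s, int t + 1) + dir_gamma = (int r, int s, int t + 2)"
    "(int r + 1, int s, int t + 1) - dir_alpha = (int r, int s + 1, int t + 1)"
    "(int r + 1, int s, int t + 1) - dir_beta = (int r + 1, int s - 1, int t + 2)"
    "(int r + 1, int s, int t + 1) - dir_gamma = (int r + 2, int s, int t)"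
    by (simp_all add: dir_alpha_def dir_beta_def dir_gamma_def)
  ultimately show ?thesis
    by (simp add: w_map_def Let_def vals mult_ac)
qed

text \<open>The isomorphism carries the chain \<open>x\<close>, \<open>y\<close>, \<open>z\<close>
  to a chain in \<open>B'\<close> with the same scalar \<open>c\<close>, so
  \<open>B_value_eqI\<close> applies to \<open>B'\<close> directly. The identity isomorphism covers
  the matrix array itself.\<close>

lemma B_value_iso:
  assumes "((V, mat_array scale d u T), (V', B')) \<in> ba_iso scale d"
  shows "B_value scale d B' = w_map d (D_map d T)"
proof
  fix p
  obtain \<sigma> where BA: "billiard_array scale d V' B'" and \<sigma>: "linear_bij scale V V' \<sigma>"
    and im: "\<And>p. p \<in> Delta (int d) \<Longrightarrow> \<sigma> ` mat_array scale d u T p = B' p"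
    using assms by (auto simp: ba_iso_def)
  have inj: "inj_on \<sigma> V" using \<sigma> by (simp add: linear_bij_def bij_betw_def)
  have add: "\<sigma> (x + y) = \<sigma> x + \<sigma> y" if "x \<in> V" "y \<in> V" for x y
    using \<sigma> that by (simp add: linear_bij_def)
  have sc: "\<sigma> (scale c x) = scale c (\<sigma> x)" if "x \<in> V" for c x
    using \<sigma> that by (simp add: linear_bij_def)
  have nz: "\<sigma> x \<noteq> 0" if "x \<in> V" "x \<noteq> 0" for x
  proof
    assume "\<sigma> x = 0"
    moreover have "\<sigma> 0 = 0" using sc[of x 0] that(1) by simp
    ultimately show False using inj that subspace_0[OF subspace_V] by (metis inj_onD)
  qed
  have mem: "\<sigma> x \<in> B' q" if "x \<in> mat_array scale d u T q" "q \<in> Delta (int d)" for x q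
    using im that by blast
  have inV: "x \<in> V" if "x \<in> mat_array scale d u T q" "q \<in> Delta (int d)" for x q
    using billiard_array_subspace(2)[OF billiard_mat_array that(2)] that(1) by blast
  show "B_value scale d B' p = w_map d (D_map d T) p"
  proof (cases "p \<in> Delta (int d - 2)")
    case False
    \<comment> \<open>Off the grid both sides are restricted functions and take the same undefined
      value.\<close>
    then show ?thesis by (cases p) (simp add: B_value_def w_map_def)
  next
    case True
    then have "d \<ge> 2" by (auto simp: Delta_def)
    then have "p \<in> Delta (int (d - 2))" using True by (simp add: of_nat_diff)
    then obtain r s t where p: "p = (int r, int s, int t)" "r + s + t = d - 2"
      by (rule Delta_natE)
    then have rst: "r + s + t + 2 = d" using \<open>d \<ge> 2\<close> by simp
    define c where "c = w_map d (D_map d T) p"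
    have c: "c = minor T (t + 2) (s + 1) * minor T (t + 1) s * minor T t (s + 2) /
        (minor T (t + 2) s * minor T t (s + 1) * minor T (t + 1) (s + 2))"
      unfolding c_def p(1) by (rule w_map_eq[OF rst])
    have c0: "c \<noteq> 0"
      unfolding c using rst by (simp add: minor_nonzero)
    obtain x y z where xyz:
      "x \<in> mat_array scale d u T (int r, int s + 1, int t + 1)" "x \<noteq> 0"
      "y \<in> mat_array scale d u T (int r + 1, int s, int t + 1)" "y \<noteq> 0"
      "z \<in> mat_array scale d u T (int r + 1, int s + 1, int t)" "z \<noteq> 0"
      "x + y \<in> mat_array scale d u T (int r, int s, int t + 2)"
      "y + z \<in> mat_array scale d u T (int r + 2, int s, int t)"
      "z + scale c x \<in> mat_array scale d u T (int r, int s + 2, int t)"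
      using mat_array_cycle[OF rst] unfolding c by metis
    have D: "(int r, int s + 1, int t + 1) \<in> Delta (int d)"
      "(int r + 1, int s, int t + 1) \<in> Delta (int d)"
      "(int r + 1, int s + 1, int t) \<in> Delta (int d)"
      "(int r, int s, int t + 2) \<in> Delta (int d)"
      "(int r + 2, int s, int t) \<in> Delta (int d)"
      "(int r, int s + 2, int t) \<in> Delta (int d)"
      using rst by (auto simp: Delta_def)
    note V = inV[OF xyz(1) D(1)] inV[OF xyz(3) D(2)] inV[OF xyz(5) D(3)]
    have "B_value scale d B' (int r, int s, int t) = c"
    proof (rule B_value_eqI[OF BA, of _ _ _ "\<sigma> x" "\<sigma> y" "\<sigma> z"])
      show "(int r, int s, int t) \<in> Delta (int d - 2)" using True p(1) by simp
      show "\<sigma> x + \<sigma> y \<in> B' (int r, int s, int t + 2)"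
        using mem[OF xyz(7) D(4)] add V by simp
      show "\<sigma> y + \<sigma> z \<in> B' (int r + 2, int s, int t)"
        using mem[OF xyz(8) D(5)] add V by simp
      show "\<sigma> z + scale c (\<sigma> x) \<in> B' (int r, int s + 2, int t)"
        using mem[OF xyz(9) D(6)] add[OF V(3) subspace_scale[OF subspace_V V(1)]] sc[OF V(1)]
        by simp
    qed (use mem xyz D V nz c0 in blast)+
    then show ?thesis by (simp add: c_def p(1))
  qed
qed

text \<open>For \<open>the_elem\<close> the set of value functions of the class must be a singleton:
  all members share one value function, and reflexivity makes the class nonempty.\<close>

lemma theta_b_map: "theta scale d (b_map scale d V u T) = w_map d (D_map d T)"
proof -
  let ?X = "b_map scale d V u T"
  have refl: "(V, mat_array scale d u T) \<in> ?X"
    unfolding b_map_def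
    by (rule equiv_class_self[OF equiv_ba_iso[OF vector_space_axioms]]) (simp add: billiard_mat_array)
  have "(\<lambda>(V, B). B_value scale d B) ` ?X = {w_map d (D_map d T)}"
  proof (intro subset_antisym subsetI)
    fix y assume "y \<in> (\<lambda>(V, B). B_value scale d B) ` ?X"
    then show "y \<in> {w_map d (D_map d T)}"
      by (auto simp: b_map_def B_value_iso)
  next
    have "B_value scale d (mat_array scale d u T) = w_map d (D_map d T)"
      using refl by (intro B_value_iso) (simp add: b_map_def)
    then show "y \<in> (\<lambda>(V, B). B_value scale d B) ` ?X" if "y \<in> {w_map d (D_map d T)}" for y
      using that refl by (intro image_eqI[OF _ refl]) simp
  qed
  then show ?thesis by (simp add: theta_def)
qed

end

theorem theorem8p6:
  fixes d :: nat
    and T :: "'a::field mat"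
    and scale :: "'a \<Rightarrow> 'v::ab_group_add \<Rightarrow> 'v"
    and V :: "'v set"
    and u :: "nat \<Rightarrow> 'v"
  assumes "d \<ge> 2"
    and "T \<in> carrier_mat (d + 1) (d + 1)"
    and "upper_triangular T"
    and "very_good d T"
    and "vector_space scale"
    and "indexed_basis scale V d u"
  shows "theta scale d (b_map scale d V u T) = w_map d (D_map d T)"
proof -
  interpret very_good_array scale d T V u
    using assms by (intro very_good_array.intro very_good_array_axioms.intro)
  show ?thesis by (rule theta_b_map)
qed

end
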